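(* Let $\boldsymbol{X}$ be an $\mathbb{R}^{\tilde n}$-valued random vector with mean $\tilde{\boldsymbol{\mu}}$ and known probability density function, let $\mathfrak{B}\subset\mathbb{R}^n$ be a compact convex set, and let $\phi$ be a risk signal temporal logic (RiSTL) formula generated by the fragment $\psi ::= \top \mid \mu^{\text{Ch}} \mid \mu^{\text{Ri}} \mid \psi'\wedge\psi''$, $\phi ::= G_{[a,b]}\psi \mid F_{[a,b]}\psi \mid \psi' U_{[a,b]}\psi'' \mid \phi'\wedge\phi''$, containing predicates $\mu_1,\dots,\mu_M$ with continuously differentiable predicate functions $h_m:\mathbb{R}^n\times\mathbb{R}^{\tilde n}\to\mathbb{R}$, each concave in $\boldsymbol{x}$. Each $\mu_m$ is either a chance predicate with parameter $\delta_m\in(0,1)$, or a risk predicate whose risk metric $R_m$ is the expected value (with parameter $\gamma_m\in\mathbb{R}$), the $VaR_{\beta_m}$, or the $CVaR_{\beta_m}$ (with parameters $\beta_m\in(0,1)$, $\gamma_m\in\mathbb{R}$). Let $c_1,\dots,c_M\in\mathbb{R}$ be such that for each $m$: $\mathfrak{X}_m^{\text{Ch}}(\delta_m)\supseteq\mathfrak{X}_m(c_m)$ if $\mu_m$ is a chance predicate, $\mathfrak{X}_m^{\text{EV}}(\gamma_m)\supseteq\mathfrak{X}_m(c_m)$ if $\mu_m$ is an expected-value risk predicate, $\mathfrak{X}_m^{\text{VaR}}(\beta_m,\gamma_m)\supseteq\mathfrak{X}_m(c_m)$ if $\mu_m$ is a VaR risk predicate, and $\mathfrak{X}_m^{\text{CVaR}}(\beta_m,\gamma_m)\supseteq\mathfrak{X}_m(c_m)$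 if $\mu_m$ is a CVaR risk predicate. Let $\varphi$ be the STL formula obtained from $\phi$ by replacing each $\mu_m$ by the deterministic predicate $\mu_m^{\text{STL}}$, which holds at time $t$ iff $h_m(\boldsymbol{x}(t),\tilde{\boldsymbol{\mu}})-c_m\ge0$. If $\boldsymbol{x}:\mathbb{R}_{\ge0}\to\mathbb{R}^n$ is such that $(\boldsymbol{x},\boldsymbol{X},0)\models\varphi$, then $(\boldsymbol{x},\boldsymbol{X},0)\models\phi$.
   Context: For a real random variable $Y$ and $\beta\in(0,1)$: $VaR_\beta(Y):=\min\{d\in\mathbb{R}\mid P(Y\le d)\ge\beta\}$ and $CVaR_\beta(Y):=E[Y\mid Y>VaR_\beta(Y)]$ (cumulative distribution function assumed smooth). A chance predicate $\mu_m$ holds at time $t$ (for signal $\boldsymbol{x}$) iff $P(h_m(\boldsymbol{x}(t),\boldsymbol{X})\ge0)\ge\delta_m$; a risk predicate holds at time $t$ iff $R_m(-h_m(\boldsymbol{x}(t),\boldsymbol{X}))\le\gamma_m$, where $R_m$ is $E[\cdot]$, $VaR_{\beta_m}(\cdot)$ or $CVaR_{\beta_m}(\cdot)$. Satisfaction $(\boldsymbol{x},\boldsymbol{X},t)\models\cdot$ is defined recursively: $\top$ always holds; $\phi'\wedge\phi''$ holds iff both hold; $\phi' U_{[a,b]}\phi''$ holds at $t$ iff there exists $t''\in[t+a,t+b]$ with $(\boldsymbol{x},\boldsymbol{X},t'')\models\phi''$ and $(\boldsymbol{x},\boldsymbol{X},t')\models\phi'$ for all $t'\in[t,t'']$; $F_{[a,b]}\phi:=\top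 U_{[a,b]}\phi$ and $G_{[a,b]}\phi:=\neg F_{[a,b]}\neg\phi$ (i.e. $\phi$ holds at all $t'\in[t+a,t+b]$). The STL formula $\varphi$ has the same semantics with predicates evaluated as stated. The sets are $\mathfrak{X}_m^{\text{Ch}}(\delta_m):=\{\boldsymbol{x}\in\mathfrak{B}\mid P(h_m(\boldsymbol{x},\boldsymbol{X})\ge0)\ge\delta_m\}$, $\mathfrak{X}_m^{\text{EV}}(\gamma_m):=\{\boldsymbol{x}\in\mathfrak{B}\mid E[-h_m(\boldsymbol{x},\boldsymbol{X})]\le\gamma_m\}$, $\mathfrak{X}_m^{\text{VaR}}(\beta_m,\gamma_m):=\{\boldsymbol{x}\in\mathfrak{B}\mid VaR_{\beta_m}(-h_m(\boldsymbol{x},\boldsymbol{X}))\le\gamma_m\}$, $\mathfrak{X}_m^{\text{CVaR}}(\beta_m,\gamma_m):=\{\boldsymbol{x}\in\mathfrak{B}\mid CVaR_{\beta_m}(-h_m(\boldsymbol{x},\boldsymbol{X}))\le\gamma_m\}$, $\mathfrak{X}_m(c_m):=\{\boldsymbol{x}\in\mathfrak{B}\mid h_m(\boldsymbol{x},\tilde{\boldsymbol{\mu}})-c_m\ge0\}$.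
   Formalization: The signal is additionally assumed to stay in the compact convex set 𝔅 for all t ≥ 0; without this the claim is false, since the set inclusions say nothing about states outside 𝔅. The risk metrics are assumed to be well defined on 𝔅. *)

theory Defs
  imports "HOL-Probability.Probability"
begin

datatype 'p formula =
    Top
  | Pred 'p
  | Neg "'p formula"
  | And "'p formula" "'p formula"
  | Until real real "'p formula" "'p formula"

abbreviation Eventually :: "real \<Rightarrow> real \<Rightarrow> 'p formula \<Rightarrow> 'p formula" where
  "Eventually a b f \<equiv> Until a b Top f"

abbreviation Globally :: "real \<Rightarrow> real \<Rightarrow> 'p formula \<Rightarrow> 'p formula" where
  "Globally a b f \<equiv> Neg (Eventually a b (Neg f))"

text \<open>In \<open>sat I x t f\<close> the parameter \<open>I\<close> says which predicates are true at which state.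
  A signal has type \<open>real \<Rightarrow> 'a\<close>, but for \<open>t \<ge> 0\<close> and nonnegative interval endpoints only its
  values at nonnegative times matter.\<close>

primrec sat :: "('p \<Rightarrow> 'a \<Rightarrow> bool) \<Rightarrow> (real \<Rightarrow> 'a) \<Rightarrow> real \<Rightarrow> 'p formula \<Rightarrow> bool" where
  "sat I x t Top \<longleftrightarrow> True"
| "sat I x t (Pred p) \<longleftrightarrow> I p (x t)"
| "sat I x t (Neg f) \<longleftrightarrow> \<not> sat I x t f"
| "sat I x t (And f g) \<longleftrightarrow> sat I x t f \<and> sat I x t g"
| "sat I x t (Until a b f g) \<longleftrightarrow>
     (\<exists>t''\<in>{t + a..t + b}. sat I x t'' g \<and> (\<forall>t'\<in>{t..t''}. sat I x t' f))"

inductive boolean_fragment :: "'p formula \<Rightarrow> bool" where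
  "boolean_fragment Top"
| "boolean_fragment (Pred p)"
| "boolean_fragment f \<Longrightarrow> boolean_fragment g \<Longrightarrow> boolean_fragment (And f g)"

inductive temporal_fragment :: "'p formula \<Rightarrow> bool" where
  "0 \<le> a \<Longrightarrow> a \<le> b \<Longrightarrow> boolean_fragment f \<Longrightarrow> temporal_fragment (Globally a b f)"
| "0 \<le> a \<Longrightarrow> a \<le> b \<Longrightarrow> boolean_fragment f \<Longrightarrow> temporal_fragment (Eventually a b f)"
| "0 \<le> a \<Longrightarrow> a \<le> b \<Longrightarrow> boolean_fragment f \<Longrightarrow> boolean_fragment g \<Longrightarrow>
     temporal_fragment (Until a b f g)"
| "temporal_fragment f \<Longrightarrow> temporal_fragment g \<Longrightarrow> temporal_fragment (And f g)"

definition value_at_risk :: "'w measure \<Rightarrow> real \<Rightarrow> ('w \<Rightarrow> real) \<Rightarrow> real" where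
  "value_at_risk \<Omega> \<beta> Y = (LEAST d. \<P>(\<omega> in \<Omega>. Y \<omega> \<le> d) \<ge> \<beta>)"

definition tail_event :: "'w measure \<Rightarrow> real \<Rightarrow> ('w \<Rightarrow> real) \<Rightarrow> 'w set" where
  "tail_event \<Omega> \<beta> Y = {\<omega> \<in> space \<Omega>. Y \<omega> > value_at_risk \<Omega> \<beta> Y}"

text \<open>Expectation of \<open>Y\<close> conditioned on the tail event.\<close>

definition cond_value_at_risk :: "'w measure \<Rightarrow> real \<Rightarrow> ('w \<Rightarrow> real) \<Rightarrow> real" where
  "cond_value_at_risk \<Omega> \<beta> Y =
     (LINT \<omega>:tail_event \<Omega> \<beta> Y|\<Omega>. Y \<omega>) / measure \<Omega> (tail_event \<Omega> \<beta> Y)"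

datatype risk_metric = EV | VaR real | CVaR real

primrec risk :: "'w measure \<Rightarrow> risk_metric \<Rightarrow> ('w \<Rightarrow> real) \<Rightarrow> real" where
  "risk \<Omega> EV Y = (LINT \<omega>|\<Omega>. Y \<omega>)"
| "risk \<Omega> (VaR \<beta>) Y = value_at_risk \<Omega> \<beta> Y"
| "risk \<Omega> (CVaR \<beta>) Y = cond_value_at_risk \<Omega> \<beta> Y"

text \<open>The real-valued integrals above are 0 when they do not exist. This predicate expresses that
  the risk of \<open>Y\<close> is meaningful, including the smoothness of the distribution function under which
  \<open>cond_value_at_risk\<close> is defined. The minimum in \<open>value_at_risk\<close> exists for every random variable
  and \<open>\<beta>\<close> strictly between 0 and 1.\<close>

primrec risk_exists :: "'w measure \<Rightarrow> risk_metric \<Rightarrow> ('w \<Rightarrow> real) \<Rightarrow> bool" where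
  "risk_exists \<Omega> EV Y \<longleftrightarrow> integrable \<Omega> Y"
| "risk_exists \<Omega> (VaR \<beta>) Y \<longleftrightarrow> True"
| "risk_exists \<Omega> (CVaR \<beta>) Y \<longleftrightarrow>
     (\<lambda>d. \<P>(\<omega> in \<Omega>. Y \<omega> \<le> d)) C1_differentiable_on UNIV \<and>
     set_integrable \<Omega> (tail_event \<Omega> \<beta> Y) Y"

primrec level_ok :: "risk_metric \<Rightarrow> bool" where
  "level_ok EV \<longleftrightarrow> True"
| "level_ok (VaR \<beta>) \<longleftrightarrow> 0 < \<beta> \<and> \<beta> < 1"
| "level_ok (CVaR \<beta>) \<longleftrightarrow> 0 < \<beta> \<and> \<beta> < 1"

text \<open>\<open>Chance \<delta>\<close> is a chance predicate, \<open>Risk R \<gamma>\<close> a risk predicate with metric \<open>R\<close>; a RiSTL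
  predicate pairs such a kind with its predicate function \<open>h\<close>.\<close>

datatype kind = Chance real | Risk risk_metric real

primrec kind_ok :: "kind \<Rightarrow> bool" where
  "kind_ok (Chance \<delta>) \<longleftrightarrow> 0 < \<delta> \<and> \<delta> < 1"
| "kind_ok (Risk R \<gamma>) \<longleftrightarrow> level_ok R"

type_synonym ('a, 'b) ristl_predicate = "('a \<Rightarrow> 'b \<Rightarrow> real) \<times> kind"

fun ristl_holds ::
  "'w measure \<Rightarrow> ('w \<Rightarrow> 'b) \<Rightarrow> ('a, 'b) ristl_predicate \<Rightarrow> 'a \<Rightarrow> bool" where
  "ristl_holds \<Omega> X (h, Chance \<delta>) y \<longleftrightarrow> \<P>(\<omega> in \<Omega>. h y (X \<omega>) \<ge> 0) \<ge> \<delta>"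
| "ristl_holds \<Omega> X (h, Risk R \<gamma>) y \<longleftrightarrow> risk \<Omega> R (\<lambda>\<omega>. - h y (X \<omega>)) \<le> \<gamma>"

text \<open>A deterministic STL predicate is given by its predicate function.\<close>

definition stl_holds :: "('a \<Rightarrow> real) \<Rightarrow> 'a \<Rightarrow> bool" where
  "stl_holds g y \<longleftrightarrow> g y \<ge> 0"

abbreviation ristl_sat ::
  "'w measure \<Rightarrow> ('w \<Rightarrow> 'b) \<Rightarrow> (real \<Rightarrow> 'a) \<Rightarrow> real \<Rightarrow> ('a, 'b) ristl_predicate formula \<Rightarrow> bool" where
  "ristl_sat \<Omega> X \<equiv> sat (ristl_holds \<Omega> X)"

abbreviation stl_sat :: "(real \<Rightarrow> 'a) \<Rightarrow> real \<Rightarrow> ('a \<Rightarrow> real) formula \<Rightarrow> bool" where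
  "stl_sat \<equiv> sat stl_holds"

definition chance_set ::
  "'w measure \<Rightarrow> ('w \<Rightarrow> 'b) \<Rightarrow> 'a set \<Rightarrow> ('a \<Rightarrow> 'b \<Rightarrow> real) \<Rightarrow> real \<Rightarrow> 'a set" where
  "chance_set \<Omega> X B h \<delta> = {y \<in> B. \<P>(\<omega> in \<Omega>. h y (X \<omega>) \<ge> 0) \<ge> \<delta>}"

definition EV_set ::
  "'w measure \<Rightarrow> ('w \<Rightarrow> 'b) \<Rightarrow> 'a set \<Rightarrow> ('a \<Rightarrow> 'b \<Rightarrow> real) \<Rightarrow> real \<Rightarrow> 'a set" where
  "EV_set \<Omega> X B h \<gamma> = {y \<in> B. (LINT \<omega>|\<Omega>. - h y (X \<omega>)) \<le> \<gamma>}"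

definition VaR_set ::
  "'w measure \<Rightarrow> ('w \<Rightarrow> 'b) \<Rightarrow> 'a set \<Rightarrow> ('a \<Rightarrow> 'b \<Rightarrow> real) \<Rightarrow> real \<Rightarrow> real \<Rightarrow> 'a set" where
  "VaR_set \<Omega> X B h \<beta> \<gamma> = {y \<in> B. value_at_risk \<Omega> \<beta> (\<lambda>\<omega>. - h y (X \<omega>)) \<le> \<gamma>}"

definition CVaR_set ::
  "'w measure \<Rightarrow> ('w \<Rightarrow> 'b) \<Rightarrow> 'a set \<Rightarrow> ('a \<Rightarrow> 'b \<Rightarrow> real) \<Rightarrow> real \<Rightarrow> real \<Rightarrow> 'a set" where
  "CVaR_set \<Omega> X B h \<beta> \<gamma> = {y \<in> B. cond_value_at_risk \<Omega> \<beta> (\<lambda>\<omega>. - h y (X \<omega>)) \<le> \<gamma>}"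

definition det_set :: "'a set \<Rightarrow> ('a \<Rightarrow> 'b \<Rightarrow> real) \<Rightarrow> 'b \<Rightarrow> real \<Rightarrow> 'a set" where
  "det_set B h \<mu> c = {y \<in> B. h y \<mu> - c \<ge> 0}"

definition continuously_differentiable ::
  "('a::real_normed_vector \<Rightarrow> 'b::real_normed_vector) \<Rightarrow> bool" where
  "continuously_differentiable f \<longleftrightarrow>
     (\<exists>D. (\<forall>z. (f has_derivative blinfun_apply (D z)) (at z)) \<and> continuous_on UNIV D)"

end

theory Submission
  imports Defs
begin

text \<open>In the fragment predicates occur only positively, since the two negations in
  \<open>Globally\<close> cancel, and satisfaction at time 0 inspects the signal only at nonnegative
  times. Hence satisfaction is monotone in the truth of the predicates along the signal, and the set
  inclusions say that each deterministic predicate implies the predicate it replaces at every point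
  of \<open>B\<close>.\<close>

text \<open>Relabelling predicates amounts to composing the interpretation with the relabelling. The
  RiSTL and the STL formula are images of one skeleton of indices, so both satisfactions become
  statements about that skeleton under two interpretations.\<close>

lemma sat_map_formula: "sat I x t (map_formula f F) \<longleftrightarrow> sat (\<lambda>p. I (f p)) x t F"
  by (induction F arbitrary: t) simp_all

text \<open>Fragment membership depends only on the shape of a formula, which
  \<open>map_formula\<close> preserves even when \<open>f\<close> is not injective.\<close>

lemma boolean_fragment_map_formulaD:
  assumes "boolean_fragment (map_formula f F)"
  shows "boolean_fragment F"
  using assms
proof (induction "map_formula f F" arbitrary: F rule: boolean_fragment.induct)
  case 1
  then show ?case by (cases F) (auto intro: boolean_fragment.intros)
next
  case (2 p)
  then show ?case by (cases F) (auto intro: boolean_fragment.intros)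
next
  case (3 g k)
  then show ?case by (cases F) (auto intro: boolean_fragment.intros)
qed

text \<open>Inversion rules oriented like the equations that induction over
  \<open>map_formula f F\<close> produces. \<open>Globally\<close> is an abbreviation, so it is
  peeled off through \<open>Neg\<close>, \<open>Until\<close> and \<open>Top\<close>.\<close>

lemma map_formula_eq_iffs:
  "Top = map_formula f F \<longleftrightarrow> F = Top"
  "Neg g = map_formula f F \<longleftrightarrow> (\<exists>G. F = Neg G \<and> g = map_formula f G)"
  "And g k = map_formula f F \<longleftrightarrow>
     (\<exists>G K. F = And G K \<and> g = map_formula f G \<and> k = map_formula f K)"
  "Until a b g k = map_formula f F \<longleftrightarrow>
     (\<exists>G K. F = Until a b G K \<and> g = map_formula f G \<and> k = map_formula f K)"
  by (cases F; auto)+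

lemma temporal_fragment_map_formulaD:
  assumes "temporal_fragment (map_formula f F)"
  shows "temporal_fragment F"
  using assms
  by (induction "map_formula f F" arbitrary: F rule: temporal_fragment.induct)
    (auto simp: map_formula_eq_iffs
      intro: temporal_fragment.intros dest!: boolean_fragment_map_formulaD)

text \<open>Without temporal operators only the state at \<open>t\<close> is inspected, so the
  implication is required at that single time.\<close>

lemma sat_mono_boolean_fragment:
  assumes "boolean_fragment F"
    and "\<And>p. p \<in> set_formula F \<Longrightarrow> I p (x t) \<Longrightarrow> J p (x t)"
    and "sat I x t F"
  shows "sat J x t F"
  using assms by induction auto

text \<open>Temporal operators are not nested and have endpoints \<ge> 0, so every inspected time is
  \<ge> \<open>t\<close>. Only conjunction recurses, at the same \<open>t\<close>.\<close>

lemma sat_mono_temporal_fragment: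
  assumes "temporal_fragment F"
    and "\<And>p s. p \<in> set_formula F \<Longrightarrow> s \<ge> t \<Longrightarrow> I p (x s) \<Longrightarrow> J p (x s)"
    and "sat I x t F"
  shows "sat J x t F"
  using assms
proof induction
  case (1 a b f)
  have "sat J x s f" if s: "s \<in> {t + a..t + b}" for s
  proof (rule sat_mono_boolean_fragment)
    show "sat I x s f" using "1.prems"(2) s by simp
    show "J p (x s)" if "p \<in> set_formula f" "I p (x s)" for p
      by (rule "1.prems"(1)) (use that s "1.hyps" in simp_all)
  qed (fact "1.hyps")
  then show ?case by simp
next
  case (2 a b f)
  \<comment> \<open>The witness time for \<open>I\<close> also serves for \<open>J\<close>.\<close>
  then obtain s where s: "s \<in> {t + a..t + b}" "sat I x s f"
    by auto
  have "sat J x s f"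
  proof (rule sat_mono_boolean_fragment)
    show "J p (x s)" if "p \<in> set_formula f" "I p (x s)" for p
      by (rule "2.prems"(1)) (use that s "2.hyps" in simp_all)
  qed (fact "2.hyps" s)+
  with s show ?case by auto
next
  case (3 a b f g)
  then obtain s where s: "s \<in> {t + a..t + b}" "sat I x s g" "\<forall>r\<in>{t..s}. sat I x r f"
    by auto
  have "sat J x s g"
  proof (rule sat_mono_boolean_fragment)
    show "J p (x s)" if "p \<in> set_formula g" "I p (x s)" for p
      by (rule "3.prems"(1)) (use that s "3.hyps" in simp_all)
  qed (fact "3.hyps" s)+
  \<comment> \<open>The left operand is inspected from \<open>t\<close> itself, not from
    \<open>t + a\<close>.\<close>
  moreover have "sat J x r f" if r: "r \<in> {t..s}" for r
  proof (rule sat_mono_boolean_fragment)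
    show "sat I x r f" using s(3) r by blast
    show "J p (x r)" if "p \<in> set_formula f" "I p (x r)" for p
      by (rule "3.prems"(1)) (use that r in simp_all)
  qed (fact "3.hyps")
  ultimately show ?case using s(1) by auto
next
  case (4 f g)
  have "sat J x t f" by (rule "4.IH"(1)) (use "4.prems" in simp_all)
  moreover have "sat J x t g" by (rule "4.IH"(2)) (use "4.prems" in simp_all)
  ultimately show ?case by simp
qed

theorem theorem1:
  fixes \<Omega> :: "'w measure"
    and X :: "'w \<Rightarrow> real ^ 'k"
    and density :: "real ^ 'k \<Rightarrow> ennreal"
    and mean :: "real ^ 'k"
    and B :: "(real ^ 'n) set"
    and M :: nat
    and h :: "nat \<Rightarrow> real ^ 'n \<Rightarrow> real ^ 'k \<Rightarrow> real"
    and kd :: "nat \<Rightarrow> kind"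
    and c :: "nat \<Rightarrow> real"
    and skeleton :: "nat formula"
    and \<phi> :: "(real ^ 'n, real ^ 'k) ristl_predicate formula"
    and \<phi>_stl :: "(real ^ 'n \<Rightarrow> real) formula"
    and x :: "real \<Rightarrow> real ^ 'n"
  assumes "prob_space \<Omega>"
    and "distributed \<Omega> lborel X density"
    and "integrable \<Omega> X" and "(LINT \<omega>|\<Omega>. X \<omega>) = mean"
    and "compact B" and "convex B"
    and "\<And>m. m \<in> {1..M} \<Longrightarrow> continuously_differentiable (\<lambda>(y, z). h m y z)"
    and "\<And>m z. m \<in> {1..M} \<Longrightarrow> concave_on UNIV (\<lambda>y. h m y z)"
    and "\<And>m. m \<in> {1..M} \<Longrightarrow> kind_ok (kd m)"
    and "\<And>m R \<gamma> y. m \<in> {1..M} \<Longrightarrow> kd m = Risk R \<gamma> \<Longrightarrow> y \<in> B \<Longrightarrow>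
           risk_exists \<Omega> R (\<lambda>\<omega>. - h m y (X \<omega>))"
    and "\<And>m \<delta>. m \<in> {1..M} \<Longrightarrow> kd m = Chance \<delta> \<Longrightarrow>
           chance_set \<Omega> X B (h m) \<delta> \<supseteq> det_set B (h m) mean (c m)"
    and "\<And>m \<gamma>. m \<in> {1..M} \<Longrightarrow> kd m = Risk EV \<gamma> \<Longrightarrow>
           EV_set \<Omega> X B (h m) \<gamma> \<supseteq> det_set B (h m) mean (c m)"
    and "\<And>m \<beta> \<gamma>. m \<in> {1..M} \<Longrightarrow> kd m = Risk (VaR \<beta>) \<gamma> \<Longrightarrow>
           VaR_set \<Omega> X B (h m) \<beta> \<gamma> \<supseteq> det_set B (h m) mean (c m)"
    and "\<And>m \<beta> \<gamma>. m \<in> {1..M} \<Longrightarrow> kd m = Risk (CVaR \<beta>) \<gamma> \<Longrightarrow>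
           CVaR_set \<Omega> X B (h m) \<beta> \<gamma> \<supseteq> det_set B (h m) mean (c m)"
    and "set_formula skeleton = {1..M}"
    and "\<phi> = map_formula (\<lambda>m. (h m, kd m)) skeleton"
    and "temporal_fragment \<phi>"
    and "\<phi>_stl = map_formula (\<lambda>m y. h m y mean - c m) skeleton"
    and "\<And>t. t \<ge> 0 \<Longrightarrow> x t \<in> B"
    and "stl_sat x 0 \<phi>_stl"
  shows "ristl_sat \<Omega> X x 0 \<phi>"
proof -
  have pred: "ristl_holds \<Omega> X (h m, kd m) (x s)"
    if m: "m \<in> {1..M}" and s: "s \<ge> 0" and holds: "stl_holds (\<lambda>y. h m y mean - c m) (x s)" for m s
  proof -
    \<comment> \<open>The inclusions speak only of points of \<open>B\<close>; \<open>s\<close>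
      \<ge> 0 places the signal there.\<close>
    have x: "x s \<in> det_set B (h m) mean (c m)"
      using holds assms(19)[OF s] by (simp add: stl_holds_def det_set_def)
    show ?thesis
    proof (cases "kd m")
      case (Chance \<delta>)
      then show ?thesis
        using x assms(11)[OF m] by (auto simp: chance_set_def)
    next
      case (Risk R \<gamma>)
      then show ?thesis
        using x assms(12-14)[OF m] by (cases R) (auto simp: EV_set_def VaR_set_def CVaR_set_def)
    qed
  qed
  \<comment> \<open>The fragment hypothesis concerns \<open>\<phi>\<close>, while monotonicity is
    applied to the skeleton.\<close>
  have "temporal_fragment skeleton"
    using assms(16,17) temporal_fragment_map_formulaD by blast
  then have "sat (\<lambda>m. ristl_holds \<Omega> X (h m, kd m)) x 0 skeleton"
  proof (rule sat_mono_temporal_fragment)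
    show "ristl_holds \<Omega> X (h m, kd m) (x s)"
      if "m \<in> set_formula skeleton" "s \<ge> 0" "stl_holds (\<lambda>y. h m y mean - c m) (x s)" for m s
      using that assms(15) by (intro pred) simp_all
    show "sat (\<lambda>m. stl_holds (\<lambda>y. h m y mean - c m)) x 0 skeleton"
      using assms(18,20) by (simp add: sat_map_formula)
  qed
  then show ?thesis
    using assms(16) by (simp add: sat_map_formula)
qed

end
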